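(* Let $k\ge 1$, let $g:\mathbb{R}^k\to\mathbb{R}^k$ be continuously differentiable, and let $r:[0,\infty)\to\mathbb{R}^k$ be differentiable. Let $u:[0,\infty)\to\mathbb{R}^k$ be a solution, for all $t\ge 0$, of $$\dot u(t)=\Big(\frac{\partial g}{\partial u}(u(t))\Big)^{-1}\big(r(t)-g(u(t))\big),$$ where the Jacobian $\frac{\partial g}{\partial u}(u(t))$ is nonsingular for every $t\ge 0$, and let $y(t)=g(u(t))$. Then $$\limsup_{t\to\infty}\|r(t)-y(t)\|\;\le\;\sup\big\{\|\dot r(t)\| : t\ge 0\big\}.$$
   Context: $\|\cdot\|$ denotes the Euclidean norm on $\mathbb{R}^k$. The setting is a feedback system with a memoryless plant: the input is $u(t)\in\mathbb{R}^k$, the output is $y(t)=g(u(t))$, and $r(t)\in\mathbb{R}^k$ is the reference signal to be tracked. $\frac{\partial g}{\partial u}(u)$ denotes the $k\times k$ Jacobian matrix of $g$ at $u$. The supremum may be $+\infty$. *)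

theory Defs
  imports "HOL-Analysis.Analysis"
begin

definition continuously_differentiable :: "(real ^ 'n \<Rightarrow> real ^ 'm) \<Rightarrow> bool" where
  "continuously_differentiable g \<longleftrightarrow>
     (\<forall>x. g differentiable (at x)) \<and> continuous_on UNIV (\<lambda>x. jacobian g (at x))"

end

theory Submission
  imports Defs
begin

text \<open>
  The feedback law is a Newton flow: it is chosen so that the Jacobian of the plant cancels,
  and along a solution the output obeys \<open>y' = r - y\<close> whatever \<open>g\<close> is. The tracking error
  \<open>e = r - y\<close> therefore solves the linear equation \<open>e' = r' - e\<close>, in which the motion of the
  reference is a disturbance of an exponentially stable system. The integrating factor \<open>exp t\<close>
  turns this into \<open>(exp t \<cdot> e)' = exp t \<cdot> r'\<close>, so a bound \<open>M\<close> on the norm of \<open>r'\<close> gives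
  \<open>norm (e t) \<le> exp (-t) * norm (e 0) + M * (1 - exp (-t))\<close>, and the right-hand side tends
  to \<open>M\<close>. Since \<open>r'\<close> need not be integrable, the step from the derivative to the increment of
  \<open>exp t \<cdot> e\<close> is made with the mean value inequality and not by integration.
\<close>

text \<open>
  Differentiating \<open>g (u t)\<close> by the chain rule multiplies the velocity of \<open>u\<close> by the Jacobian of
  \<open>g\<close>, which undoes the inverse in the flow.
\<close>

lemma newton_flow_output_derivative:
  fixes g :: "real ^ 'k \<Rightarrow> real ^ 'k" and u :: "real \<Rightarrow> real ^ 'k"
  assumes "g differentiable (at (u t))"
    and "invertible (jacobian g (at (u t)))"
    and "(u has_vector_derivative matrix_inv (jacobian g (at (u t))) *v w) (at t within S)"
  shows "((\<lambda>t. g (u t)) has_vector_derivative w) (at t within S)"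
proof -
  let ?J = "jacobian g (at (u t))"
  have "(g has_derivative (\<lambda>h. ?J *v h)) (at (u t))"
    using assms(1) jacobian_works by blast
  then have "(g has_derivative (\<lambda>h. ?J *v h)) (at (u t) within u ` S)"
    by (rule has_derivative_at_withinI)
  from vector_derivative_diff_chain_within[OF assms(3) this]
  have "((g \<circ> u) has_vector_derivative ?J *v (matrix_inv ?J *v w)) (at t within S)" .
  moreover have "?J ** matrix_inv ?J = mat 1"
    using someI_ex[OF assms(2)[unfolded invertible_def]] by (simp add: matrix_inv_def)
  then have "?J *v (matrix_inv ?J *v w) = w"
    by (simp add: matrix_vector_mul_assoc)
  ultimately show ?thesis by (simp add: o_def)
qed

text \<open>
  The integrating factor \<open>exp t\<close> removes the decay term. The estimate
  \<open>norm (exp t *\<^sub>R d t) \<le> M * exp t\<close> then compares the growth of \<open>exp t *\<^sub>R e t\<close> with that of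
  \<open>M * exp t\<close>, and dividing by \<open>exp T\<close> gives the bound.
\<close>

lemma disturbed_exponential_decay:
  fixes e d :: "real \<Rightarrow> 'a::real_normed_vector"
  assumes e: "\<And>t. t \<ge> 0 \<Longrightarrow> (e has_vector_derivative d t - e t) (at t within {0..})"
    and d: "\<And>t. t \<ge> 0 \<Longrightarrow> norm (d t) \<le> M"
    and "T \<ge> 0"
  shows "norm (e T) \<le> exp (- T) * norm (e 0) + M * (1 - exp (- T))"
proof (cases "T = 0")
  case False
  with \<open>T \<ge> 0\<close> have "T > 0" by simp
  let ?f = "\<lambda>t. exp t *\<^sub>R e t"
  have f: "(?f has_vector_derivative exp t *\<^sub>R d t) (at t within {0..})" if "t \<ge> 0" for t
    using has_vector_derivative_scaleR[OF DERIV_subset[OF DERIV_exp subset_UNIV] e[OF that]]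
    by (simp add: scaleR_diff_right)
  have cont: "continuous_on {0..T} ?f"
  proof (rule continuous_on_subset)
    show "continuous_on {0..} ?f"
      using f has_vector_derivative_continuous
      by (fastforce simp: continuous_on_eq_continuous_within)
  qed simp
  have "norm (?f T - ?f 0) \<le> M * exp T - M * exp 0"
  proof (rule differentiable_bound_general[OF \<open>T > 0\<close> cont])
    show "continuous_on {0..T} (\<lambda>t. M * exp t)"
      by (intro continuous_intros)
    fix t :: real assume t: "0 < t" "t < T"
    have "at t within {0..} = at t"
      using t by (intro at_within_interior) simp
    with f[of t] t show "(?f has_vector_derivative exp t *\<^sub>R d t) (at t)" by simp
    show "((\<lambda>t. M * exp t) has_vector_derivative M * exp t) (at t)"
      unfolding has_real_derivative_iff_has_vector_derivative[symmetric]
      by (auto intro!: derivative_eq_intros)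
    show "norm (exp t *\<^sub>R d t) \<le> M * exp t"
      using d[of t] t by (simp add: mult.commute)
  qed
  then have "norm (?f T) \<le> norm (e 0) + M * (exp T - 1)"
    using norm_triangle_sub[of "?f T" "?f 0"] by (simp add: algebra_simps)
  then have "exp (- T) * (exp T * norm (e T)) \<le> exp (- T) * (norm (e 0) + M * (exp T - 1))"
    by (intro mult_left_mono) simp_all
  then show ?thesis
    by (simp add: exp_minus field_simps)
qed simp

theorem proposition1:
  fixes g :: "real ^ 'k \<Rightarrow> real ^ 'k"
    and r u y :: "real \<Rightarrow> real ^ 'k"
  assumes "continuously_differentiable g"
    and "r differentiable_on {0..}"
    and "\<And>t. t \<ge> 0 \<Longrightarrow> invertible (jacobian g (at (u t)))"
    and "\<And>t. t \<ge> 0 \<Longrightarrow>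
           (u has_vector_derivative matrix_inv (jacobian g (at (u t))) *v (r t - g (u t)))
             (at t within {0..})"
    and "\<And>t. t \<ge> 0 \<Longrightarrow> y t = g (u t)"
  shows "Limsup at_top (\<lambda>t. ereal (norm (r t - y t)))
           \<le> (SUP t\<in>{0..}. ereal (norm (vector_derivative r (at t within {0..}))))"
    (is "_ \<le> ?S")
proof (cases "?S = \<infinity>")
  case False
  define d where "d t = vector_derivative r (at t within {0..})" for t
  define e where "e t = r t - g (u t)" for t
  have upper: "ereal (norm (d t)) \<le> ?S" if "t \<ge> 0" for t
    unfolding d_def using that by (intro SUP_upper) simp
  \<comment> \<open>The norm at \<open>t = 0\<close> is a real lower bound of the supremum, which excludes \<open>-\<infinity>\<close>.\<close>
  have "?S \<noteq> - \<infinity>"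
    using order_less_le_trans[OF _ upper[of 0], of "- \<infinity>"] by force
  with False obtain M where M: "?S = ereal M"
    by (metis ereal_cases)
  have r': "(r has_vector_derivative d t) (at t within {0..})" if "t \<ge> 0" for t
  proof -
    have "r differentiable (at t within {0..})"
      using assms(2) that unfolding differentiable_on_def by blast
    then show ?thesis
      unfolding d_def by (rule vector_derivative_works[THEN iffD1])
  qed
  have e': "(e has_vector_derivative d t - e t) (at t within {0..})" if "t \<ge> 0" for t
  proof -
    have "g differentiable (at (u t))"
      using assms(1) unfolding continuously_differentiable_def by blast
    then have "((\<lambda>t. g (u t)) has_vector_derivative e t) (at t within {0..})"
      unfolding e_def
      using assms(3)[OF that] assms(4)[OF that] by (rule newton_flow_output_derivative)
    with r'[OF that] show ?thesis
      unfolding e_def[abs_def] by (rule has_vector_derivative_diff)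
  qed
  let ?b = "\<lambda>t. exp (- t) * norm (e 0) + M * (1 - exp (- t))"
  have bound: "norm (r t - y t) \<le> ?b t" if "t \<ge> 0" for t
    using disturbed_exponential_decay[OF e', of M t] upper M assms(5) that
    by (simp add: e_def)
  have "((\<lambda>t::real. exp (- t)) \<longlongrightarrow> 0) at_top"
    by (rule filterlim_compose[OF exp_at_bot filterlim_uminus_at_bot_at_top])
  then have "(?b \<longlongrightarrow> 0 * norm (e 0) + M * (1 - 0)) at_top"
    by (intro tendsto_intros)
  then have lim: "((\<lambda>t. ereal (?b t)) \<longlongrightarrow> ereal M) at_top"
    by simp
  have "Limsup at_top (\<lambda>t. ereal (norm (r t - y t))) \<le> Limsup at_top (\<lambda>t. ereal (?b t))"
    using bound by (intro Limsup_mono eventually_mono[OF eventually_ge_at_top[of 0]]) simp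
  also have "\<dots> = ereal M"
    using lim by (intro lim_imp_Limsup) simp_all
  finally show ?thesis using M by simp
qed simp

end
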